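(* Let $\delta>0$ and $\varepsilon>0$. There exists $n_0(\varepsilon)$ such that for all $n\ge n_0(\varepsilon)$ and every plane integral point set $\mathcal{P}$ consisting of $n$ points of which at least $n^\delta$ are collinear, we have $$\operatorname{diam}(\mathcal{P})\ge n^{\frac{\delta}{4\log 2\,(1+\varepsilon)}\log\log n}.$$
   Context: A plane integral point set is a set of $n$ points in the Euclidean plane with pairwise integral distances, not all on a common line; its diameter $\operatorname{diam}(\mathcal{P})$ is the largest occurring distance between two of its points. $\log$ denotes the natural logarithm. *)

theory Defs
  imports "HOL-Analysis.Analysis"
begin

definition plane_integral_point_set :: "(real^2) set \<Rightarrow> bool" where
  "plane_integral_point_set P \<longleftrightarrow>
     finite P \<and> (\<forall>x\<in>P. \<forall>y\<in>P. dist x y \<in> \<int>) \<and> \<not> collinear P"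

text \<open>The library's \<^const>\<open>diameter\<close> is a supremum; on a finite nonempty set it is the largest
  occurring distance.\<close>

lemma diameter_eq_Max:
  fixes P :: "(real^2) set"
  assumes "finite P" "P \<noteq> {}"
  shows "diameter P = Max {dist x y | x y. x \<in> P \<and> y \<in> P}"
proof -
  have eq: "{dist x y | x y. x \<in> P \<and> y \<in> P} = (\<lambda>(x, y). dist x y) ` (P \<times> P)"
    by auto
  have "Sup ((\<lambda>(x, y). dist x y) ` (P \<times> P)) = Max ((\<lambda>(x, y). dist x y) ` (P \<times> P))"
    using assms by (intro cSup_eq_Max) auto
  then show ?thesis
    using assms unfolding eq diameter_def by simp
qed

end

theory Submission
  imports Defs "HOL-Computational_Algebra.Primes" "HOL-Real_Asymp.Real_Asymp"
begin

text \<open>Fix a point \<open>A\<close> on the line, a second one \<open>B\<close> at distance \<open>b\<close>, a point \<open>C\<close> off the line,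
  and let \<open>q\<close> and \<open>h\<close> be the coordinate (from \<open>A\<close>) of the foot of the perpendicular from \<open>C\<close> and
  its length. For a point \<open>X\<close> of the line with coordinate \<open>t\<close>,
  \<open>(2 b |CX|)\<^sup>2 - (2 b t - 2 b q)\<^sup>2\<close> is the fixed positive integer \<open>N = 4 b\<^sup>2 h\<^sup>2\<close>, where \<open>2 b q\<close>
  is an integer by the law of cosines. So \<open>X\<close> is determined by a divisor of \<open>N\<close>, and \<open>N\<close> is at most
  four times the fourth power of the diameter. Wigert's bound on the number of divisors then gives
  the claim. To get a threshold that does not depend on \<open>\<delta>\<close>, the parameter in that bound is chosen
  in terms of \<open>n\<close> rather than \<open>N\<close>; the error term is absorbed because the diameter is at least of
  order \<open>sqrt n\<close>, the points being at mutual distance at least 1.\<close>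

section \<open>Wigert's bound on the number of divisors\<close>

text \<open>A divisor is determined by its multiplicities at the primes dividing \<open>N\<close>,
  and each is at most that of \<open>N\<close>. Restricting the multiplicity function to these
  primes makes it an element of a finite extensional product.\<close>

lemma card_divisors_le_prod:
  fixes N :: nat
  assumes "N > 0"
  shows "card {d. d dvd N} \<le> (\<Prod>p\<in>prime_factors N. multiplicity p N + 1)"
proof -
  define f where "f d = restrict (\<lambda>p. multiplicity p d) (prime_factors N)" for d
  have "inj_on f {d. d dvd N}"
  proof (rule inj_onI)
    fix x y assume xy: "x \<in> {d. d dvd N}" "y \<in> {d. d dvd N}" and eq: "f x = f y"
    have nz: "x \<noteq> 0" "y \<noteq> 0" using xy assms by auto
    have "multiplicity p x = multiplicity p y" if p: "prime p" for p
    proof (cases "p dvd N")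
      case True
      then have "p \<in> prime_factors N" using p assms by (simp add: in_prime_factors_iff)
      then show ?thesis using fun_cong[OF eq, of p] by (simp add: f_def)
    next
      case False
      then have "\<not> p dvd x" "\<not> p dvd y" using xy by (auto dest: dvd_trans)
      then show ?thesis by (simp add: not_dvd_imp_multiplicity_0)
    qed
    then show "x = y" using nz multiplicity_eq_imp_eq[of x y] by simp
  qed
  moreover have "f ` {d. d dvd N} \<subseteq> (\<Pi>\<^sub>E p\<in>prime_factors N. {..multiplicity p N})"
    using assms by (auto simp: f_def intro!: dvd_imp_multiplicity_le)
  ultimately have "card {d. d dvd N} \<le> card (\<Pi>\<^sub>E p\<in>prime_factors N. {..multiplicity p N})"
    by (intro card_inj_on_le) (auto intro!: finite_PiE)
  then show ?thesis by (simp add: card_PiE)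
qed

text \<open>The left side is the number of divisors of a prime power. If \<open>p\<close> is at
  least \<open>2 powr (1 / s)\<close>, then \<open>p powr s\<close> is at least 2 and
  \<open>k + 1 \<le> 2 ^ k\<close> suffices; a smaller \<open>p\<close> costs a constant factor that
  depends on neither \<open>p\<close> nor \<open>k\<close>.\<close>

lemma Suc_le_powr_prime_power:
  fixes p k :: nat and s :: real
  assumes "p \<ge> 2" "s > 0"
  shows "real (k + 1) \<le> (if real p < 2 powr (1 / s) then exp (1 / (s * ln 2)) else 1)
                          * (real p ^ k) powr s"
proof (cases "real p < 2 powr (1 / s)")
  case True
  define x where "x = real k * s * ln 2"
  have x0: "x \<ge> 0" using assms by (simp add: x_def)
  have "real k = x * (1 / (s * ln 2))" using assms by (simp add: x_def)
  then have "real (k + 1) = 1 + x * (1 / (s * ln 2))" by simp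
  \<comment> \<open>Both 1 and \<open>x\<close> are at most \<open>exp x\<close>, which is
    \<open>(2 ^ k) powr s\<close>.\<close>
  also have "\<dots> \<le> exp x + exp x * (1 / (s * ln 2))"
    using x0 assms exp_ge_add_one_self[of x]
    by (intro add_mono mult_right_mono) (auto intro: order.trans[of _ "1 + x"])
  also have "\<dots> = (1 + 1 / (s * ln 2)) * exp x" by (simp add: algebra_simps)
  also have "\<dots> \<le> exp (1 / (s * ln 2)) * exp x"
    by (intro mult_right_mono exp_ge_add_one_self) auto
  also have "exp x = (2 ^ k) powr s"
    by (simp add: x_def powr_def ln_realpow mult_ac)
  also have "\<dots> \<le> (real p ^ k) powr s"
    using assms by (intro powr_mono2 power_mono) auto
  finally show ?thesis using True by simp
next
  case False
  have "real (k + 1) \<le> 2 ^ k"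
    using of_nat_mono[of "k + 1" "2 ^ k", where 'a = real] by (simp add: Suc_leI)
  also have "\<dots> = (2 powr (1 / s)) powr (k * s)"
    using assms by (simp add: powr_powr powr_realpow)
  also have "\<dots> \<le> real p powr (k * s)"
    using False assms by (intro powr_mono2) auto
  also have "\<dots> = (real p ^ k) powr s"
    using assms by (simp add: powr_powr flip: powr_realpow)
  finally show ?thesis using False by simp
qed

text \<open>Primes \<open>p \<ge> 2 powr (1 / s)\<close> contribute a factor at most 1 to \<open>d(N) / N powr s\<close>; there are
  at most \<open>2 powr (1 / s)\<close> smaller ones.\<close>

lemma card_divisors_le_powr:
  fixes N :: nat and s :: real
  assumes "N > 0" "s > 0"
  shows "real (card {d. d dvd N}) \<le> real N powr s * exp (2 powr (1 / s) / (s * ln 2))"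
proof -
  define B where "B = 2 powr (1 / s)"
  define E where "E = exp (1 / (s * ln 2))"
  let ?F = "prime_factors N"
  have p2: "p \<ge> 2" if "p \<in> ?F" for p using that by (auto intro: prime_ge_2_nat)
  have "real (card {d. d dvd N}) \<le> (\<Prod>p\<in>?F. real (multiplicity p N + 1))"
    using of_nat_mono[OF card_divisors_le_prod[OF assms(1)], where 'a = real] by simp
  also have "\<dots> \<le> (\<Prod>p\<in>?F. (if real p < B then E else 1) * (real p ^ multiplicity p N) powr s)"
    unfolding B_def E_def
    by (intro prod_mono conjI Suc_le_powr_prime_power p2 assms) auto
  also have "\<dots> = (\<Prod>p\<in>?F. if real p < B then E else 1)
                   * (\<Prod>p\<in>?F. (real p ^ multiplicity p N) powr s)"
    by (rule prod.distrib)
  also have "(\<Prod>p\<in>?F. (real p ^ multiplicity p N) powr s)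
             = (\<Prod>p\<in>?F. real p ^ multiplicity p N) powr s"
    by (simp add: prod_powr_distrib)
  also have "(\<Prod>p\<in>?F. real p ^ multiplicity p N) = real N"
    using arg_cong[OF prime_factorization_nat[OF assms(1)], of real] by simp
  also have "(\<Prod>p\<in>?F. if real p < B then E else 1) = E ^ card {p\<in>?F. real p < B}"
    by (simp add: prod.If_cases Int_def)
  also have "\<dots> = E powr real (card {p\<in>?F. real p < B})"
    by (simp add: powr_realpow E_def)
  \<comment> \<open>The small primes are counted crudely as integers from 1 to \<open>B\<close>; for
    the later choice of \<open>s\<close> this remains of lower order.\<close>
  also have "\<dots> \<le> E powr B"
  proof (rule powr_mono)
    have "{p\<in>?F. real p < B} \<subseteq> {1..nat \<lfloor>B\<rfloor>}"
      using p2 by (force simp: le_nat_iff le_floor_iff)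
    then have "card {p\<in>?F. real p < B} \<le> nat \<lfloor>B\<rfloor>"
      using card_mono[of "{1..nat \<lfloor>B\<rfloor>}"] by fastforce
    then have "real (card {p\<in>?F. real p < B}) \<le> real (nat \<lfloor>B\<rfloor>)"
      by (simp only: of_nat_le_iff)
    also have "\<dots> \<le> B" by (intro of_nat_floor) (simp add: B_def)
    finally show "real (card {p\<in>?F. real p < B}) \<le> B" .
  qed (use assms in \<open>simp add: E_def\<close>)
  also have "E powr B = exp (B / (s * ln 2))" by (simp add: E_def powr_def)
  finally show ?thesis
    by (simp add: B_def mult.commute mult_left_mono mult_right_mono)
qed

section \<open>Collinear points as divisors of a fixed integer\<close>

text \<open>The difference of squares factors as \<open>u X * v X\<close>, two positive integers
  with product \<open>N\<close>. So \<open>u X\<close> divides \<open>N\<close>, and it determines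
  \<open>v X\<close> and hence \<open>X\<close>. The bound on \<open>N\<close> comes from dropping
  \<open>m\<^sup>2\<close> in \<open>R\<close>.\<close>

lemma card_integral_collinear_le_card_divisors:
  fixes C A :: "'a::euclidean_space"
  assumes Q: "collinear Q" "A \<in> Q" "B \<in> Q" "A \<noteq> B" and C: "\<not> collinear {A, B, C}"
    and int: "\<And>X Y. X \<in> insert C Q \<Longrightarrow> Y \<in> insert C Q \<Longrightarrow> dist X Y \<in> \<int>"
  obtains N :: nat where "N > 0" "real N \<le> 4 * (dist A B)\<^sup>2 * (dist A C)\<^sup>2"
    "card Q \<le> card {d. d dvd N}"
proof -
  define b where "b = dist A B"
  define e where "e = (B - A) /\<^sub>R b"
  define q where "q = (C - A) \<bullet> e"
  have b0: "b > 0" using Q by (simp add: b_def)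
  have "norm e = 1" using b0 by (simp add: e_def b_def dist_norm norm_minus_commute)
  then have ee: "e \<bullet> e = 1" by (simp add: norm_eq_1)
  have Be: "B - A = b *\<^sub>R e" using b0 by (simp add: e_def)
  define t where "t X = (X - A) \<bullet> e" for X
  have Xt: "X - A = t X *\<^sub>R e" if "X \<in> Q" for X
  proof -
    have "collinear {A, B, X}" using Q that by (auto intro: collinear_subset)
    then have "collinear {X, A, B}" by (simp add: insert_commute)
    then have "collinear {0, X - A, B - A}" by (subst (asm) collinear_3) auto
    then have "collinear {0, B - A, X - A}" by (simp add: insert_commute)
    then obtain c where "X - A = c *\<^sub>R (B - A)"
      using Q(4) unfolding collinear_lemma by (auto intro: that[of 0])
    then have c: "X - A = (c * b) *\<^sub>R e" by (simp add: Be)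
    then show ?thesis using ee by (simp add: t_def)
  qed
  have tint: "t X \<in> \<int>" if "X \<in> Q" for X
  proof -
    have "dist X A = \<bar>t X\<bar>" using Xt[OF that] \<open>norm e = 1\<close> by (simp add: dist_norm)
    then show ?thesis using int[of X A] that Q by (auto simp: abs_if split: if_splits)
  qed
  have expand: "(w - x *\<^sub>R e) \<bullet> (w - x *\<^sub>R e) = w \<bullet> w - 2 * x * (w \<bullet> e) + x\<^sup>2" for w x
    using ee by (simp add: inner_diff inner_commute power2_eq_square algebra_simps)
  have tB: "t B = b" using Be ee by (simp add: t_def)
  have dC: "(dist C X)\<^sup>2 = (dist C A)\<^sup>2 - 2 * t X * q + (t X)\<^sup>2" if "X \<in> Q" for X
  proof -
    have "C - X = (C - A) - t X *\<^sub>R e" using Xt[OF that] by (simp add: algebra_simps)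
    then have "(dist C X)\<^sup>2 = ((C - A) - t X *\<^sub>R e) \<bullet> ((C - A) - t X *\<^sub>R e)"
      by (simp only: dist_norm power2_norm_eq_inner)
    also have "\<dots> = (dist C A)\<^sup>2 - 2 * t X * q + (t X)\<^sup>2"
      by (simp only: expand dist_norm power2_norm_eq_inner q_def)
    finally show ?thesis .
  qed
  have Cint: "dist C X \<in> \<int>" if "X \<in> Q" for X using int[of C X] that by simp
  have bint: "b \<in> \<int>" using int Q by (simp add: b_def)
  \<comment> \<open>The foot coordinate \<open>q\<close> need not be an integer; the factor
    \<open>2 * b\<close> clears its denominator, as \<open>dC\<close> at \<open>B\<close>
    shows.\<close>
  define m where "m = 2 * b * q"
  have "m = (dist C A)\<^sup>2 + b\<^sup>2 - (dist C B)\<^sup>2"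
    using dC[OF Q(3)] by (simp add: tB m_def)
  then have mint: "m \<in> \<int>" using Cint Q bint by auto
  define R where "R = 4 * b\<^sup>2 * (dist C A)\<^sup>2 - m\<^sup>2"
  have Rint: "R \<in> \<int>" unfolding R_def using Cint Q bint mint by auto
  have R: "R = 4 * b\<^sup>2 * ((dist C A)\<^sup>2 - q\<^sup>2)" by (simp add: R_def m_def power_mult_distrib algebra_simps)
  have "q\<^sup>2 < (dist C A)\<^sup>2"
  proof -
    \<comment> \<open>This is the vector from the foot of the perpendicular to \<open>C\<close>; it
      vanishes only if \<open>C\<close> lies on the line.\<close>
    have "((C - A) - q *\<^sub>R e) \<noteq> 0"
    proof
      assume "(C - A) - q *\<^sub>R e = 0"
      then have "C - A = (q / b) *\<^sub>R (B - A)" using b0 Be by simp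
      then have "collinear {0, B - A, C - A}" unfolding collinear_lemma by blast
      then have "collinear {0, C - A, B - A}" by (simp add: insert_commute)
      then have "collinear {C, A, B}" by (subst collinear_3) auto
      then show False using C by (simp add: insert_commute)
    qed
    then have "((C - A) - q *\<^sub>R e) \<bullet> ((C - A) - q *\<^sub>R e) > 0" by simp
    also have "((C - A) - q *\<^sub>R e) \<bullet> ((C - A) - q *\<^sub>R e) = (dist C A)\<^sup>2 - q\<^sup>2"
      by (simp only: expand dist_norm power2_norm_eq_inner q_def[symmetric])
        (simp add: power2_eq_square)
    finally show ?thesis by simp
  qed
  then have R0: "R > 0" using b0 by (simp add: R)
  define N where "N = nat \<lfloor>R\<rfloor>"
  have NR: "real N = R" using Rint R0 by (auto simp: N_def elim!: Ints_cases)
  define u where "u X = 2 * b * dist C X + (2 * b * t X - m)" for X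
  define v where "v X = 2 * b * dist C X - (2 * b * t X - m)" for X
  have uv: "u X * v X = R" if "X \<in> Q" for X
  proof -
    have "u X * v X = 4 * b\<^sup>2 * (dist C X)\<^sup>2 - (2 * b * t X - m)\<^sup>2"
      by (simp add: u_def v_def power2_eq_square algebra_simps)
    also have "\<dots> = R" unfolding dC[OF that] R_def m_def by (simp add: power2_eq_square algebra_simps)
    finally show ?thesis .
  qed
  have uvpos: "u X > 0 \<and> v X > 0" if "X \<in> Q" for X
  proof -
    \<comment> \<open>The sum is \<open>4 * b * dist C X\<close>; two factors with positive product
      and nonnegative sum are both positive.\<close>
    have "u X + v X \<ge> 0" using b0 by (simp add: u_def v_def)
    moreover have "u X * v X > 0" using uv[OF that] R0 by simp
    ultimately show ?thesis by (auto simp: zero_less_mult_iff)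
  qed
  have uvint: "u X \<in> \<int>" "v X \<in> \<int>" if "X \<in> Q" for X
    unfolding u_def v_def using that Cint bint tint mint by auto
  have un: "real (nat \<lfloor>u X\<rfloor>) = u X" "real (nat \<lfloor>v X\<rfloor>) = v X" if "X \<in> Q" for X
    using uvint[OF that] uvpos[OF that] by (auto elim!: Ints_cases)
  have "card Q \<le> card {d. d dvd N}"
  proof (rule card_inj_on_le[where f = "\<lambda>X. nat \<lfloor>u X\<rfloor>"])
    show "inj_on (\<lambda>X. nat \<lfloor>u X\<rfloor>) Q"
    proof (rule inj_onI)
      fix X Y assume XY: "X \<in> Q" "Y \<in> Q" "nat \<lfloor>u X\<rfloor> = nat \<lfloor>u Y\<rfloor>"
      then have eq: "u X = u Y" using un by metis
      then have "v X = v Y" using uv XY uvpos by (metis less_irrefl mult_left_cancel)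
      with eq have "b * t X = b * t Y" unfolding u_def v_def by argo
      then have "t X = t Y" using b0 by simp
      then show "X = Y" using Xt XY by (metis diff_add_cancel)
    qed
    show "(\<lambda>X. nat \<lfloor>u X\<rfloor>) ` Q \<subseteq> {d. d dvd N}"
    proof safe
      fix X assume X: "X \<in> Q"
      have "real (nat \<lfloor>u X\<rfloor> * nat \<lfloor>v X\<rfloor>) = real N"
        using un[OF X] uv[OF X] NR by simp
      then have "nat \<lfloor>u X\<rfloor> * nat \<lfloor>v X\<rfloor> = N" by linarith
      then show "nat \<lfloor>u X\<rfloor> dvd N" by (metis dvd_triv_left)
    qed
    show "finite {d. d dvd N}" using NR R0 by (intro finite_divisors_nat) auto
  qed
  moreover have "R \<le> 4 * b\<^sup>2 * (dist C A)\<^sup>2" by (simp add: R_def)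
  ultimately show ?thesis using that[of N] NR R0 by (simp add: b_def dist_commute)
qed

section \<open>Number of points against diameter\<close>

text \<open>Pigeonhole on a square grid of side 1/2: two points in one cell are less than 1 apart
  already in the l1 norm, so each cell holds at most one point.\<close>

lemma card_separated_le_diameter:
  fixes P :: "(real^2) set"
  assumes "finite P" and sep: "\<And>x y. x \<in> P \<Longrightarrow> y \<in> P \<Longrightarrow> x \<noteq> y \<Longrightarrow> dist x y \<ge> 1"
    and "diameter P \<ge> 1"
  shows "real (card P) \<le> 49 * (diameter P)\<^sup>2"
proof (cases "P = {}")
  case False
  then obtain a where a: "a \<in> P" by auto
  define D where "D = diameter P"
  \<comment> \<open>The extra 1 is for the negative side, where the floor of \<open>- 2 * D\<close>
    may fall one below the negated floor of \<open>2 * D\<close>.\<close>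
  define K where "K = \<lfloor>2 * D\<rfloor> + 1"
  define f where "f x = (\<lfloor>2 * (x - a) $ 1\<rfloor>, \<lfloor>2 * (x - a) $ 2\<rfloor>)" for x :: "real^2"
  have K0: "K \<ge> 0" using assms by (simp add: K_def D_def)
  have "inj_on f P"
  proof (rule inj_onI, rule ccontr)
    fix x y assume xy: "x \<in> P" "y \<in> P" "f x = f y" "x \<noteq> y"
    have "\<lfloor>2 * (x - a) $ i\<rfloor> = \<lfloor>2 * (y - a) $ i\<rfloor>" for i
      using xy(3) exhaust_2[of i] by (auto simp: f_def)
    then have "\<bar>2 * (x - a) $ i - 2 * (y - a) $ i\<bar> < 1" for i
      using floor_correct[of "2 * (x - a) $ i"] floor_correct[of "2 * (y - a) $ i"]
      by (simp only: abs_less_iff) linarith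
    moreover have "2 * (x - a) $ i - 2 * (y - a) $ i = 2 * (x - y) $ i" for i by simp
    ultimately have "2 * \<bar>(x - y) $ i\<bar> < 1" for i by (metis abs_mult abs_numeral)
    then have c: "\<bar>(x - y) $ i\<bar> < 1 / 2" for i by (simp only: pos_less_divide_eq zero_less_numeral mult.commute)
    have "dist x y = norm (x - y)" by (simp add: dist_norm)
    also have "\<dots> \<le> (\<Sum>i\<in>UNIV. \<bar>(x - y) $ i\<bar>)" by (rule norm_le_l1_cart)
    also have "\<dots> < 1" using c[of 1] c[of 2] by (simp add: sum_2)
    finally show False using sep xy by fastforce
  qed
  moreover have "f ` P \<subseteq> {-K..K} \<times> {-K..K}"
  proof safe
    fix x y z assume x: "x \<in> P" and eq: "(y, z) = f x"
    have "norm (x - a) \<le> D"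
      using diameter_bounded_bound[OF finite_imp_bounded[OF assms(1)] x a] by (simp add: D_def dist_norm)
    then have "\<lfloor>2 * (x - a) $ i\<rfloor> \<in> {-K..K}" for i
      using component_le_norm_cart[of "x - a" i] unfolding K_def atLeastAtMost_iff by linarith
    then show "y \<in> {-K..K}" "z \<in> {-K..K}" using eq by (auto simp: f_def)
  qed
  ultimately have "card P \<le> card ({-K..K} \<times> {-K..K})"
    by (intro card_inj_on_le[of f]) auto
  also have "\<dots> = (nat (2 * K + 1))\<^sup>2" by (simp add: card_cartesian_product power2_eq_square)
  finally have "real (card P) \<le> (real (nat (2 * K + 1)))\<^sup>2"
    by (metis of_nat_le_iff of_nat_power)
  also have "real (nat (2 * K + 1)) = real_of_int (2 * K + 1)" using K0 by simp
  finally have card: "real (card P) \<le> (real_of_int (2 * K + 1))\<^sup>2" .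
  \<comment> \<open>Hence \<open>2 * K + 1\<close> is at most \<open>4 * D + 3\<close>, and
    \<open>D \<ge> 1\<close> turns this into \<open>7 * D\<close>, the source of 49.\<close>
  have "real_of_int K \<le> 2 * D + 1" by (simp add: K_def)
  then have "real_of_int (2 * K + 1) \<le> 7 * D"
    using assms(3) by (simp add: D_def)
  then have "(real_of_int (2 * K + 1))\<^sup>2 \<le> (7 * D)\<^sup>2" using K0 by (intro power_mono) auto
  with card show ?thesis by (simp add: D_def power_mult_distrib)
qed (use assms in auto)

section \<open>Size of the error term\<close>

text \<open>The left side of the last inequality collects the lower-order terms of the logarithmic
  divisor bound for \<open>s = (1 + \<eta>) * ln 2 / ln (ln n)\<close>. They are dominated because
  the exponent \<open>1 / (1 + \<eta>)\<close> is below 1. Since \<delta> does not occur, the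
  threshold is uniform in it.\<close>

lemma eventually_error_term_le:
  fixes \<eta> :: real
  assumes "\<eta> > 0"
  shows "eventually (\<lambda>n::nat. ln (real n) > 1 \<and> ln (real n) \<ge> 2 * ln 49 \<and>
     (1 + \<eta>) * ln 2 / ln (ln (real n)) * ln 4
       + ln (real n) powr (1 / (1 + \<eta>)) * ln (ln (real n)) / ((1 + \<eta>) * (ln 2)\<^sup>2)
     \<le> \<eta> * ln 2 * ln (real n) / ln (ln (real n))) sequentially"
proof -
  define a where "a = 1 / (1 + \<eta>)"
  define c where "c = 1 / ((1 + \<eta>) * (ln 2)\<^sup>2)"
  define k where "k = (1 + \<eta>) * ln 2 * ln 4"
  define l where "l = \<eta> * ln 2"
  have pos: "0 < a" "a < 1" "c > 0" "k > 0" "l > 0"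
    using assms by (simp_all add: a_def c_def k_def l_def)
  have "eventually (\<lambda>L. k / ln L + c * (L powr a * ln L) \<le> l * L / ln L) at_top"
    using pos by real_asymp
  moreover have "filterlim (\<lambda>n::nat. ln (real n)) at_top sequentially" by real_asymp
  ultimately have "eventually (\<lambda>n::nat. k / ln (ln (real n)) + c * (ln (real n) powr a * ln (ln (real n)))
      \<le> l * ln (real n) / ln (ln (real n))) sequentially"
    by (rule eventually_compose_filterlim)
  moreover have "eventually (\<lambda>n::nat. ln (real n) > 1) sequentially" by real_asymp
  moreover have "eventually (\<lambda>n::nat. ln (real n) \<ge> 2 * ln 49) sequentially" by real_asymp
  ultimately show ?thesis
    by eventually_elim (simp add: a_def c_def k_def l_def mult_ac)
qed

section \<open>Combining the divisor, packing and error estimates\<close>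

theorem theorem4:
  fixes \<epsilon> :: real
  assumes "\<epsilon> > 0"
  shows "\<exists>n0 :: nat. \<forall>\<delta> :: real. \<forall>n :: nat. \<forall>P :: (real^2) set.
           \<delta> > 0 \<and> n \<ge> n0 \<and> plane_integral_point_set P \<and> card P = n \<and>
           (\<exists>Q \<subseteq> P. collinear Q \<and> real (card Q) \<ge> real n powr \<delta>) \<longrightarrow>
           diameter P \<ge> real n powr (\<delta> / (4 * ln 2 * (1 + \<epsilon>)) * ln (ln (real n)))"
proof -
  \<comment> \<open>One half of \<epsilon> is spent in the choice of \<open>s\<close>, the other on
    the error term: \<open>1 + 2 * \<eta> = 1 + \<epsilon>\<close>.\<close>
  define \<eta> where "\<eta> = \<epsilon> / 2"
  have \<eta>: "\<eta> > 0" using assms by (simp add: \<eta>_def)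
  obtain n0 where n0: "\<And>n. n \<ge> n0 \<Longrightarrow> ln (real n) > 1 \<and> ln (real n) \<ge> 2 * ln 49 \<and>
     (1 + \<eta>) * ln 2 / ln (ln (real n)) * ln 4
       + ln (real n) powr (1 / (1 + \<eta>)) * ln (ln (real n)) / ((1 + \<eta>) * (ln 2)\<^sup>2)
     \<le> \<eta> * ln 2 * ln (real n) / ln (ln (real n))"
    using eventually_error_term_le[OF \<eta>] unfolding eventually_sequentially by blast
  show ?thesis
  proof (intro exI[of _ n0] allI impI, elim conjE exE)
    fix \<delta> :: real and n :: nat and P Q :: "(real^2) set"
    assume \<delta>: "\<delta> > 0" and n: "n \<ge> n0" and P: "plane_integral_point_set P" and cP: "card P = n"
      and Q: "Q \<subseteq> P" "collinear Q" "real n powr \<delta> \<le> real (card Q)"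
    define D where "D = diameter P"
    define L where "L = ln (real n)"
    define M where "M = ln L"
    have L1: "L > 1" and L49: "L \<ge> 2 * ln 49" and err:
      "(1 + \<eta>) * ln 2 / M * ln 4 + L powr (1 / (1 + \<eta>)) * M / ((1 + \<eta>) * (ln 2)\<^sup>2)
        \<le> \<eta> * ln 2 * L / M"
      using n0[OF n] by (auto simp: L_def M_def)
    have M0: "M > 0" using L1 by (simp add: M_def)
    have n1: "real n > 1"
    proof (rule ccontr)
      assume "\<not> real n > 1"
      then have "n = 0 \<or> n = 1" by auto
      then show False using L1 by (auto simp: L_def)
    qed
    have fin: "finite P" and int: "\<And>x y. x \<in> P \<Longrightarrow> y \<in> P \<Longrightarrow> dist x y \<in> \<int>"
      and nc: "\<not> collinear P"
      using P by (auto simp: plane_integral_point_set_def)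
    have le_D: "dist x y \<le> D" if "x \<in> P" "y \<in> P" for x y
      unfolding D_def using diameter_bounded_bound[OF finite_imp_bounded[OF fin] that] .
    have sep: "dist x y \<ge> 1" if "x \<in> P" "y \<in> P" "x \<noteq> y" for x y
      using int[OF that(1,2)] that(3) by (auto elim!: Ints_cases) (metis dist_pos_lt of_int_0_less_iff zless_imp_add1_zle add_0)
    have "real n powr \<delta> > 1" using n1 \<delta> by (simp add: gr_one_powr)
    then have "\<not> card Q \<le> 1" using Q(3) by linarith
    moreover have "finite Q" using Q(1) fin finite_subset by blast
    ultimately obtain A B where AB: "A \<in> Q" "B \<in> Q" "A \<noteq> B"
      by (auto simp: card_le_Suc0_iff_eq)
    have D1: "D \<ge> 1" using sep[of A B] le_D[of A B] AB Q(1) by force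
    obtain C where C: "C \<in> P" "\<not> collinear {A, B, C}"
      using nc AB collinear_triples[of A B "P"] AB Q(1)
      by (metis insert_absorb subsetD)
    obtain N :: nat where N: "N > 0" "real N \<le> 4 * (dist A B)\<^sup>2 * (dist A C)\<^sup>2"
        "card Q \<le> card {d. d dvd N}"
      using card_integral_collinear_le_card_divisors[OF Q(2) AB C(2)] int C(1) Q(1) by blast
    have "real N \<le> 4 * D\<^sup>2 * D\<^sup>2"
      using le_D[of A B] le_D[of A C] AB C(1) Q(1) D1
      by (intro order.trans[OF N(2)] mult_mono power_mono) auto
    then have "ln (real N) \<le> ln (4 * D ^ 4)"
      using N(1) by (simp add: power2_eq_square power4_eq_xxxx mult.assoc)
    then have lnN: "ln (real N) \<le> ln 4 + 4 * ln D"
      using D1 by (simp add: ln_mult ln_realpow)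
    have "real n \<le> 49 * D\<^sup>2"
      using card_separated_le_diameter[OF fin sep] D1 cP by (simp add: D_def)
    then have "L \<le> ln (49 * D\<^sup>2)" unfolding L_def using n1 by (intro ln_mono) auto
    then have "L \<le> ln 49 + 2 * ln D" using D1 by (simp add: ln_mult ln_realpow)
    \<comment> \<open>\<open>L49\<close> makes \<open>ln 49\<close> at most half of
      \<open>L\<close>.\<close>
    then have LD: "L \<le> 4 * ln D" using L49 by simp
    \<comment> \<open>This makes \<open>2 powr (1 / s)\<close> a power of \<open>ln n\<close> with exponent below 1.\<close>
    define s where "s = (1 + \<eta>) * ln 2 / M"
    have s0: "s > 0" using \<eta> M0 by (simp add: s_def)
    have two: "2 powr (1 / s) = L powr (1 / (1 + \<eta>))"
      using \<eta> L1 by (simp add: powr_def s_def M_def)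
    have "real n powr \<delta> \<le> real N powr s * exp (2 powr (1 / s) / (s * ln 2))"
      using Q(3) N(3) card_divisors_le_powr[OF N(1) s0] by linarith
    then have "ln (real n powr \<delta>) \<le> ln (real N powr s * exp (2 powr (1 / s) / (s * ln 2)))"
      using n1 by (intro ln_mono) auto
    then have "\<delta> * L \<le> s * ln (real N) + L powr (1 / (1 + \<eta>)) / (s * ln 2)"
      unfolding two[symmetric] using n1 N(1) by (simp add: ln_mult L_def)
    also have "L powr (1 / (1 + \<eta>)) / (s * ln 2)
               = L powr (1 / (1 + \<eta>)) * M / ((1 + \<eta>) * (ln 2)\<^sup>2)"
      by (simp add: s_def power2_eq_square)
    also have "s * ln (real N) \<le> s * (ln 4 + 4 * ln D)" using lnN s0 by simp
    also have "s * (ln 4 + 4 * ln D) + L powr (1 / (1 + \<eta>)) * M / ((1 + \<eta>) * (ln 2)\<^sup>2)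
               \<le> s * (4 * ln D) + \<eta> * ln 2 * L / M"
      using err unfolding s_def[symmetric] by (simp add: distrib_left)
    \<comment> \<open>The error, so far measured in \<open>L\<close>, is charged to
      \<open>ln D\<close>, so that it merges with the main term.\<close>
    also have "\<eta> * ln 2 * L / M \<le> \<eta> * ln 2 * (4 * ln D) / M"
      using LD \<eta> M0 by (intro divide_right_mono mult_left_mono) auto
    also have "s * (4 * ln D) + \<eta> * ln 2 * (4 * ln D) / M = 4 * ln 2 * (1 + \<epsilon>) * ln D / M"
      using M0 by (simp add: s_def \<eta>_def field_simps)
    finally have "\<delta> * L \<le> 4 * ln 2 * (1 + \<epsilon>) * ln D / M" by simp
    then have "\<delta> / (4 * ln 2 * (1 + \<epsilon>)) * M * L \<le> ln D"
    proof -
      define k where "k = 4 * ln 2 * (1 + \<epsilon>)"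
      have "k > 0" using assms by (simp add: k_def)
      then show ?thesis
        using \<open>\<delta> * L \<le> 4 * ln 2 * (1 + \<epsilon>) * ln D / M\<close> M0
        unfolding k_def[symmetric] by (simp add: field_simps)
    qed
    then have "exp (\<delta> / (4 * ln 2 * (1 + \<epsilon>)) * M * L) \<le> D"
      using D1 by (metis exp_le_cancel_iff exp_ln less_le_trans zero_less_one)
    then show "real n powr (\<delta> / (4 * ln 2 * (1 + \<epsilon>)) * ln (ln (real n))) \<le> diameter P"
      using n1 by (simp add: powr_def L_def M_def D_def)
  qed
qed

end
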